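(* The property of being a connected Roman dominating function and the property of being a total Roman dominating function are both nice Roman domination properties.
   Context: Graphs are finite, simple and undirected; $N(v)$, $N[v]=N(v)\cup\{v\}$ are neighborhoods. In a graph $H$, for $A\subseteq V(H)$ and $v\in A$, $P_{H,A}(v)=N_H[v]\setminus N_H[A\setminus\{v\}]$. For $f:V\to\{0,1,2\}$, $V_i(f)=\{v: f(v)=i\}$; $\chi_S$ is the characteristic function of $S$. A Roman dominating function (Rdf) is an $f:V\to\{0,1,2\}$ such that each $v\in V_0(f)$ has a neighbor in $V_2(f)$. A total Roman dominating function is an Rdf $f$ such that every $v\in V_1(f)\cup V_2(f)$ has a neighbor in $V_1(f)\cup V_2(f)$; a connected Roman dominating function is an Rdf $f$ such that $G[V_1(f)\cup V_2(f)]$ is connected. A property $\mathcal{P}$ assigns to each graph a set of functions $V\to\{0,1,2\}$. $\mathcal{P}$ is a nice Roman domination property if for every graph $G=(V,E)$ and every $f$ with property $\mathcal{P}$: (1) $f$ is an Rdf; (2) for all $v\in V_0(f)$, $f+\chi_{\{v\}}$ has $\mathcal{P}$; (3) for all $v\in V_2(f)$, $f-\chi_{\{v\}}$ has $\mathcal{P}$ iff $P_{G[V\setminus V_1(f)],V_2(f)}(v)\subseteq\{v\}$. *)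

theory Defs
  imports
    "Graph_Theory.Digraph_Component"
    "HOL-Library.FuncSet"
    "HOL-Library.Indicator_Function"
begin

text \<open>
  A finite simple undirected graph is a \<open>pair_graph\<close>: finite vertex set, and edges given by a
  symmetric irreflexive relation on the vertices. A function on the vertex set is an extensional
  function (\<open>\<rightarrow>\<^sub>E\<close>), so that its values outside the vertex set carry no information.
\<close>

definition nbhd :: "('a, 'b) pre_digraph \<Rightarrow> 'a \<Rightarrow> 'a set" where
  "nbhd H v = {u. v \<rightarrow>\<^bsub>H\<^esub> u}"

definition closed_nbhd :: "('a, 'b) pre_digraph \<Rightarrow> 'a \<Rightarrow> 'a set" where
  "closed_nbhd H v = nbhd H v \<union> {v}"

definition closed_nbhd_set :: "('a, 'b) pre_digraph \<Rightarrow> 'a set \<Rightarrow> 'a set" where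
  "closed_nbhd_set H A = (\<Union>v\<in>A. closed_nbhd H v)"

definition private_nbhd :: "('a, 'b) pre_digraph \<Rightarrow> 'a set \<Rightarrow> 'a \<Rightarrow> 'a set" where
  "private_nbhd H A v = closed_nbhd H v - closed_nbhd_set H (A - {v})"

definition level :: "'a pair_pre_digraph \<Rightarrow> ('a \<Rightarrow> nat) \<Rightarrow> nat \<Rightarrow> 'a set" where
  "level G f i = {v \<in> pverts G. f v = i}"

definition rdf :: "'a pair_pre_digraph \<Rightarrow> ('a \<Rightarrow> nat) set" where
  "rdf G = {f \<in> pverts G \<rightarrow>\<^sub>E {0, 1, 2}. \<forall>v \<in> level G f 0. \<exists>u \<in> level G f 2. u \<in> nbhd G v}"

definition total_rdf :: "'a pair_pre_digraph \<Rightarrow> ('a \<Rightarrow> nat) set" where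
  "total_rdf G = {f \<in> rdf G.
     \<forall>v \<in> level G f 1 \<union> level G f 2. \<exists>u \<in> level G f 1 \<union> level G f 2. u \<in> nbhd G v}"

text \<open>
  The library's connectedness excludes the graph without vertices. For \<open>f\<close> in \<open>rdf G\<close> the set
  \<open>level G f 1 \<union> level G f 2\<close> is empty only if \<open>G\<close> itself has no vertices.
\<close>

definition connected_rdf :: "'a pair_pre_digraph \<Rightarrow> ('a \<Rightarrow> nat) set" where
  "connected_rdf G = {f \<in> rdf G.
     Digraph_Component.connected (with_proj G \<restriction> (level G f 1 \<union> level G f 2))}"

text \<open>
  Addition and subtraction of a characteristic function, as functions on the vertex set. The
  truncated subtraction on \<open>nat\<close> is harmless: \<open>sub_chi G f S\<close> is only used where \<open>f\<close> is
  positive on \<open>S\<close>.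
\<close>

definition add_chi :: "'a pair_pre_digraph \<Rightarrow> ('a \<Rightarrow> nat) \<Rightarrow> 'a set \<Rightarrow> 'a \<Rightarrow> nat" where
  "add_chi G f S = (\<lambda>u\<in>pverts G. f u + indicator S u)"

definition sub_chi :: "'a pair_pre_digraph \<Rightarrow> ('a \<Rightarrow> nat) \<Rightarrow> 'a set \<Rightarrow> 'a \<Rightarrow> nat" where
  "sub_chi G f S = (\<lambda>u\<in>pverts G. f u - indicator S u)"

definition nice_roman_domination_property ::
    "('a pair_pre_digraph \<Rightarrow> ('a \<Rightarrow> nat) set) \<Rightarrow> bool" where
  "nice_roman_domination_property P \<longleftrightarrow>
     (\<forall>G. pair_graph G \<longrightarrow> (\<forall>f \<in> P G.
        f \<in> rdf G \<and>
        (\<forall>v \<in> level G f 0. add_chi G f {v} \<in> P G) \<and>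
        (\<forall>v \<in> level G f 2. sub_chi G f {v} \<in> P G \<longleftrightarrow>
           private_nbhd (with_proj G \<restriction> (pverts G - level G f 1)) (level G f 2) v \<subseteq> {v})))"

end

theory Submission
  imports Defs
begin

text \<open>
  Raising a vertex from 0 to 1 enlarges the support by a vertex that is adjacent to the old support,
  and lowering a vertex from 2 to 1 leaves the support unchanged. Being total and being connected
  depend only on the support and survive the addition of an adjacent vertex, so only the domination
  condition matters, and lowering \<open>v\<close> destroys it exactly if some vertex of value 0 has \<open>v\<close> as its
  only neighbour of value 2, that is, if \<open>v\<close> has a private neighbour other than itself.
\<close>

text \<open>The vertex \<open>u\<close> is a hub: old vertices reach it and are reached from it by
  walks inside \<open>S\<close>, and \<open>v\<close> by the new edge. Connectedness is taken over
  symmetrized arcs, so the single arc from \<open>u\<close> to \<open>v\<close> serves both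
  directions.\<close>

lemma connected_induce_insert:
  assumes conn: "Digraph_Component.connected (G \<restriction> S)" and u: "u \<in> S" and uv: "u \<rightarrow>\<^bsub>G\<^esub> v"
  shows "Digraph_Component.connected (G \<restriction> insert v S)"
proof -
  let ?R = "(arcs_ends (G \<restriction> S))\<^sup>s" and ?R' = "(arcs_ends (G \<restriction> insert v S))\<^sup>s"
  let ?X = "rtrancl_on (insert v S) ?R'"
  have sub: "?R \<subseteq> ?R'"
    by (auto simp: symcl_def arcs_ends_conv)
  have uv': "(u, v) \<in> ?R'" "(v, u) \<in> ?R'"
    using u uv by (auto simp: symcl_def arcs_ends_conv image_iff)
  have old: "(x, y) \<in> ?X" if "x \<in> S" "y \<in> S" for x y
  proof -
    have "(x, y) \<in> rtrancl_on S ?R"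
      using conn that by (simp add: connected_conv)
    then show ?thesis
      by (rule rtrancl_on_mono[rotated -1]) (use sub in auto)
  qed
  have to_u: "(x, u) \<in> ?X" and from_u: "(u, x) \<in> ?X" if "x \<in> insert v S" for x
    using that old u uv'
    by (auto intro: rtrancl_on_into_rtrancl_on converse_rtrancl_on_into_rtrancl_on)
  have "(x, y) \<in> ?X" if "x \<in> insert v S" "y \<in> insert v S" for x y
    using to_u[OF that(1)] from_u[OF that(2)] by (rule rtrancl_on_trans)
  then show ?thesis
    by (simp add: connected_conv)
qed

lemma level_add_chi:
  assumes "v \<in> level G f 0"
  shows "level G (add_chi G f {v}) 0 = level G f 0 - {v}"
    and "level G (add_chi G f {v}) 1 = insert v (level G f 1)"
    and "level G (add_chi G f {v}) 2 = level G f 2"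
  using assms by (auto simp: level_def add_chi_def indicator_def split: if_splits)

lemma level_sub_chi:
  assumes "v \<in> level G f 2"
  shows "level G (sub_chi G f {v}) 0 = level G f 0"
    and "level G (sub_chi G f {v}) 1 = insert v (level G f 1)"
    and "level G (sub_chi G f {v}) 2 = level G f 2 - {v}"
  using assms by (auto simp: level_def sub_chi_def indicator_def split: if_splits)

lemma add_chi_in_rdf:
  assumes f: "f \<in> rdf G" and v: "v \<in> level G f 0"
  shows "add_chi G f {v} \<in> rdf G"
proof -
  have "add_chi G f {v} \<in> pverts G \<rightarrow>\<^sub>E {0, 1, 2}"
    using f v by (auto simp: rdf_def add_chi_def level_def indicator_def)
  then show ?thesis
    using f by (simp add: rdf_def level_add_chi[OF v])
qed

text \<open>The graph \<open>?H\<close> omits the vertices of value 1, which require no dominator.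
  Other vertices of value 2 lie in their own closed neighbourhoods, so a private neighbour of
  \<open>v\<close> other than \<open>v\<close> has value 0 and loses its last dominator when
  \<open>v\<close> is lowered.\<close>

lemma sub_chi_in_rdf_iff:
  assumes "pair_graph G" and f: "f \<in> rdf G" and v: "v \<in> level G f 2"
  shows "sub_chi G f {v} \<in> rdf G \<longleftrightarrow>
    private_nbhd (with_proj G \<restriction> (pverts G - level G f 1)) (level G f 2) v \<subseteq> {v}"
    (is "_ \<longleftrightarrow> private_nbhd ?H _ _ \<subseteq> _")
proof -
  interpret pair_graph G by fact
  have nbhd: "x \<in> nbhd G y \<longleftrightarrow> (x, y) \<in> parcs G" for x y
    using arcs_symmetric by (auto simp: nbhd_def)
  have H: "x \<rightarrow>\<^bsub>?H\<^esub> y \<longleftrightarrow> (x, y) \<in> parcs G \<and> x \<notin> level G f 1 \<and> y \<notin> level G f 1" for x y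
    by (auto simp: arcs_ends_conv image_iff dest: in_arcsD1 in_arcsD2)
  have verts: "pverts G = level G f 0 \<union> level G f 1 \<union> level G f 2"
    using f by (auto simp: rdf_def level_def)
  have disj: "level G f 0 \<inter> level G f 1 = {}" "level G f 2 \<inter> level G f 1 = {}"
      "level G f 0 \<inter> level G f 2 = {}"
    by (auto simp: level_def)
  have dom: "\<exists>w \<in> level G f 2. (w, u) \<in> parcs G" if "u \<in> level G f 0" for u
    using f that by (simp add: rdf_def nbhd)
  have "sub_chi G f {v} \<in> pverts G \<rightarrow>\<^sub>E {0, 1, 2}"
    using f by (fastforce simp: rdf_def sub_chi_def indicator_def PiE_iff)
  then have "sub_chi G f {v} \<in> rdf G \<longleftrightarrow>
      (\<forall>u \<in> level G f 0. \<exists>w \<in> level G f 2 - {v}. (w, u) \<in> parcs G)"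
    by (simp add: rdf_def level_sub_chi[OF v] nbhd del: One_nat_def)
  \<comment> \<open>A vertex not adjacent to \<open>v\<close> gets from \<open>dom\<close> a
    dominator that differs from \<open>v\<close>.\<close>
  also have "\<dots> \<longleftrightarrow> (\<forall>u \<in> level G f 0. (v, u) \<in> parcs G \<longrightarrow>
      (\<exists>w \<in> level G f 2 - {v}. (w, u) \<in> parcs G))"
    using dom by blast
  \<comment> \<open>The range of \<open>u\<close> grows from value 0 to all values but 1. The
    vertices gained have value 2, and the disjunct \<open>u = w\<close> settles them.\<close>
  also have "\<dots> \<longleftrightarrow> (\<forall>u. (v, u) \<in> parcs G \<and> u \<notin> level G f 1 \<and> u \<noteq> v \<longrightarrow>
      (\<exists>w \<in> level G f 2 - {v}. u = w \<or> (w, u) \<in> parcs G))"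
    using v verts disj by (blast dest: in_arcsD2)
  also have "\<dots> \<longleftrightarrow> private_nbhd ?H (level G f 2) v \<subseteq> {v}"
  proof -
    \<comment> \<open>Having value 2, \<open>w\<close> survives the deletion, so only its neighbours
      of value 1 disappear.\<close>
    have nb: "closed_nbhd ?H w = insert w {u. (w, u) \<in> parcs G \<and> u \<notin> level G f 1}"
      if "w \<in> level G f 2" for w
      using that disj by (auto simp: closed_nbhd_def nbhd_def H simp del: One_nat_def)
    have "private_nbhd ?H (level G f 2) v =
        insert v {u. (v, u) \<in> parcs G \<and> u \<notin> level G f 1}
        - (\<Union>w \<in> level G f 2 - {v}. insert w {u. (w, u) \<in> parcs G \<and> u \<notin> level G f 1})"
      using v by (simp add: private_nbhd_def closed_nbhd_set_def nb del: One_nat_def)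
    then show ?thesis
      by auto
  qed
  finally show ?thesis .
qed

text \<open>Isolates what connectedness and totality share, so that raising and lowering a vertex
  are treated once for both.\<close>

lemma nice_roman_domination_propertyI:
  fixes Q :: "'a pair_pre_digraph \<Rightarrow> 'a set \<Rightarrow> bool"
  assumes P: "\<And>G. P G = {f \<in> rdf G. Q G (level G f 1 \<union> level G f 2)}"
    and Q: "\<And>G S u v. \<lbrakk>pair_graph G; Q G S; u \<in> S; (u, v) \<in> parcs G\<rbrakk> \<Longrightarrow> Q G (insert v S)"
  shows "nice_roman_domination_property P"
  unfolding nice_roman_domination_property_def
proof (intro allI impI ballI conjI)
  fix G f
  assume G: "pair_graph G" and "f \<in> P G"
  then have f: "f \<in> rdf G" and supp: "Q G (level G f 1 \<union> level G f 2)"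
    by (auto simp: P)
  interpret pair_graph G by fact
  show "f \<in> rdf G" by fact
  show "add_chi G f {v} \<in> P G" if v: "v \<in> level G f 0" for v
  proof -
    \<comment> \<open>A dominator of \<open>v\<close> is the vertex of the old support to which
      \<open>v\<close> gets attached.\<close>
    obtain u where "u \<in> level G f 2" "(u, v) \<in> parcs G"
      using f v arcs_symmetric by (auto simp: rdf_def nbhd_def)
    then have "Q G (insert v (level G f 1 \<union> level G f 2))"
      using Q[OF G supp] by blast
    then show ?thesis
      using add_chi_in_rdf[OF f v] by (simp add: P level_add_chi[OF v] del: One_nat_def)
  qed
  show "sub_chi G f {v} \<in> P G \<longleftrightarrow>
      private_nbhd (with_proj G \<restriction> (pverts G - level G f 1)) (level G f 2) v \<subseteq> {v}"
    if v: "v \<in> level G f 2" for v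
  proof -
    \<comment> \<open>The support is unchanged, so \<open>Q\<close> persists and the equivalence
      reduces to the one for \<open>rdf\<close>.\<close>
    have "insert v (level G f 1) \<union> (level G f 2 - {v}) = level G f 1 \<union> level G f 2"
      using v by auto
    then show ?thesis
      using supp sub_chi_in_rdf_iff[OF G f v] by (simp add: P level_sub_chi[OF v] del: One_nat_def)
  qed
qed

theorem theorem4:
  shows "nice_roman_domination_property
           (connected_rdf :: 'a pair_pre_digraph \<Rightarrow> ('a \<Rightarrow> nat) set)
       \<and> nice_roman_domination_property
           (total_rdf :: 'a pair_pre_digraph \<Rightarrow> ('a \<Rightarrow> nat) set)"
proof
  show "nice_roman_domination_property
      (connected_rdf :: 'a pair_pre_digraph \<Rightarrow> ('a \<Rightarrow> nat) set)"
    by (rule nice_roman_domination_propertyI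
        [where Q = "\<lambda>G S. Digraph_Component.connected (with_proj G \<restriction> S)"])
      (auto simp: connected_rdf_def intro: connected_induce_insert)
  show "nice_roman_domination_property
      (total_rdf :: 'a pair_pre_digraph \<Rightarrow> ('a \<Rightarrow> nat) set)"
  proof (rule nice_roman_domination_propertyI
      [where Q = "\<lambda>G S. \<forall>v \<in> S. \<exists>u \<in> S. u \<in> nbhd (with_proj G) v"])
    fix G :: "'a pair_pre_digraph" and S u v
    assume "pair_graph G" and S: "\<forall>v \<in> S. \<exists>u \<in> S. u \<in> nbhd (with_proj G) v"
      and u: "u \<in> S" "(u, v) \<in> parcs G"
    interpret pair_graph G by fact
    \<comment> \<open>The reversed edge provides the neighbour that \<open>v\<close> needs; old
      vertices keep theirs.\<close>
    have "u \<in> nbhd (with_proj G) v"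
      using u arcs_symmetric by (auto simp: nbhd_def)
    then show "\<forall>x \<in> insert v S. \<exists>y \<in> insert v S. y \<in> nbhd (with_proj G) x"
      using S u by blast
  qed (simp add: total_rdf_def)
qed

end
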